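(* For any order $\alpha\in[0,\infty]$ Rényi divergence is jointly quasi-convex in its arguments. That is, for any two pairs of probability distributions $(P_0,Q_0)$ and $(P_1,Q_1)$ on a measurable space $(\mathcal{X},\mathcal{F})$, and any $\lambda\in(0,1)$, $$D_\alpha\big((1-\lambda)P_0+\lambda P_1\,\big\|\,(1-\lambda)Q_0+\lambda Q_1\big)\le\max\{D_\alpha(P_0\|Q_0),D_\alpha(P_1\|Q_1)\}.$$
   Context: Rényi divergence: let $P,Q$ be probability distributions with densities $p,q$ with respect to a dominating $\sigma$-finite measure $\mu$ (whose choice is immaterial). For $\alpha\in(0,1)\cup(1,\infty)$, $D_\alpha(P\|Q)=\frac{1}{\alpha-1}\ln\int p^\alpha q^{1-\alpha}\,d\mu\in[0,\infty]$, where for $\alpha>1$ one reads $p^\alpha q^{1-\alpha}$ as $p^\alpha/q^{\alpha-1}$ with the conventions $0/0=0$ and $x/0=\infty$ for $x>0$. Further $D_0(P\|Q)=\lim_{\alpha\downarrow0}D_\alpha(P\|Q)$, $D_1(P\|Q)=\lim_{\alpha\uparrow1}D_\alpha(P\|Q)$ and $D_\infty(P\|Q)=\lim_{\alpha\uparrow\infty}D_\alpha(P\|Q)$ (these limits always exist in $[0,\infty]$). *)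

theory Defs
  imports "HOL-Probability.Probability"
begin

definition add_measure :: "'a measure \<Rightarrow> 'a measure \<Rightarrow> 'a measure" where
  "add_measure M N = measure_of (space M) (sets M) (\<lambda>A. emeasure M A + emeasure N A)"

lemma space_add_measure [simp]: "space (add_measure M N) = space M"
  by (simp add: add_measure_def)

lemma sets_add_measure [simp, measurable_cong]: "sets (add_measure M N) = sets M"
  by (simp add: add_measure_def)

lemma emeasure_add_measure:
  assumes "sets N = sets M"
  shows "emeasure (add_measure M N) A = emeasure M A + emeasure N A"
proof (cases "A \<in> sets M")
  case True
  have "countably_additive (sets M) (\<lambda>A. emeasure M A + emeasure N A)"
  proof (rule countably_additiveI)
    fix F :: "nat \<Rightarrow> 'a set"
    assume F: "range F \<subseteq> sets M" "disjoint_family F"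
    have "(\<Sum>i. emeasure M (F i) + emeasure N (F i))
        = (\<Sum>i. emeasure M (F i)) + (\<Sum>i. emeasure N (F i))"
      by (simp add: suminf_add)
    then show "(\<Sum>i. emeasure M (F i) + emeasure N (F i))
        = emeasure M (\<Union>i. F i) + emeasure N (\<Union>i. F i)"
      using F assms by (simp add: suminf_emeasure)
  qed
  moreover have "positive (sets M) (\<lambda>A. emeasure M A + emeasure N A)"
    by (simp add: positive_def)
  ultimately show ?thesis
    using True unfolding add_measure_def
    by (simp add: emeasure_measure_of_sigma sets.sigma_algebra_axioms)
next
  case False
  then show ?thesis
    using assms by (simp add: emeasure_notin_sets)
qed

definition mixture :: "real \<Rightarrow> 'a measure \<Rightarrow> 'a measure \<Rightarrow> 'a measure" where
  "mixture l M N = add_measure (scale_measure (ennreal (1 - l)) M) (scale_measure (ennreal l) N)"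

lemma sets_mixture [simp, measurable_cong]: "sets (mixture l M N) = sets M"
  by (simp add: mixture_def)

lemma space_mixture [simp]: "space (mixture l M N) = space M"
  by (simp add: mixture_def space_scale_measure)

lemma emeasure_mixture:
  assumes "sets N = sets M"
  shows "emeasure (mixture l M N) A = ennreal (1 - l) * emeasure M A + ennreal l * emeasure N A"
  using assms by (simp add: mixture_def emeasure_add_measure)

lemma prob_space_mixture:
  assumes "prob_space M" "prob_space N" "sets N = sets M" "0 \<le> l" "l \<le> 1"
  shows "prob_space (mixture l M N)"
proof (rule prob_spaceI)
  have "space N = space M"
    using assms(3) by (rule sets_eq_imp_space_eq)
  then show "emeasure (mixture l M N) (space (mixture l M N)) = 1"
    using assms prob_space.emeasure_space_1[of M] prob_space.emeasure_space_1[of N]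
    by (simp add: emeasure_mixture flip: ennreal_plus)
qed

definition ln_ennreal :: "ennreal \<Rightarrow> ereal" where
  "ln_ennreal x = (if x = 0 then -\<infinity> else if x = \<infinity> then \<infinity> else ereal (ln (enn2real x)))"

text \<open>
  For \<open>a > 1\<close> the conventions \<open>0 / 0 = 0\<close> and \<open>x / 0 = \<infinity>\<close> for \<open>x > 0\<close> are those of
  division on \<^typ>\<open>ennreal\<close>. For \<open>a < 1\<close> the quotient form would be wrong where \<open>q = 0\<close>;
  there \<open>0 powr (1 - a) = 0\<close> gives the intended value.
\<close>

definition renyi_integrand :: "real \<Rightarrow> real \<Rightarrow> real \<Rightarrow> ennreal" where
  "renyi_integrand a p q =
    (if a < 1 then ennreal (p powr a * q powr (1 - a))
     else ennreal (p powr a) / ennreal (q powr (a - 1)))"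

definition renyi_div_wrt :: "real \<Rightarrow> 'a measure \<Rightarrow> ('a \<Rightarrow> real) \<Rightarrow> ('a \<Rightarrow> real) \<Rightarrow> ereal" where
  "renyi_div_wrt a \<mu> p q =
    ereal (1 / (a - 1)) * ln_ennreal (\<integral>\<^sup>+x. renyi_integrand a (p x) (q x) \<partial>\<mu>)"

text \<open>
  The dominating measure is fixed to be \<open>P + Q\<close>; lemma \<open>renyi_div_simple_eq\<close> below shows that
  every \<open>\<sigma>\<close>-finite dominating measure, with any densities, gives the same value.
\<close>

definition renyi_div_simple :: "real \<Rightarrow> 'a measure \<Rightarrow> 'a measure \<Rightarrow> ereal" where
  "renyi_div_simple a P Q =
    renyi_div_wrt a (add_measure P Q)
      (\<lambda>x. enn2real (RN_deriv (add_measure P Q) P x))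
      (\<lambda>x. enn2real (RN_deriv (add_measure P Q) Q x))"

definition renyi_div :: "ennreal \<Rightarrow> 'a measure \<Rightarrow> 'a measure \<Rightarrow> ereal" where
  "renyi_div \<alpha> P Q =
    (if \<alpha> = 0 then Lim (at_right 0) (\<lambda>a. renyi_div_simple a P Q)
     else if \<alpha> = 1 then Lim (at_left 1) (\<lambda>a. renyi_div_simple a P Q)
     else if \<alpha> = \<infinity> then Lim at_top (\<lambda>a. renyi_div_simple a P Q)
     else renyi_div_simple (enn2real \<alpha>) P Q)"

lemma measurable_renyi_integrand [measurable]:
  assumes [measurable]: "p \<in> borel_measurable M" "q \<in> borel_measurable M"
  shows "(\<lambda>x. renyi_integrand a (p x) (q x)) \<in> borel_measurable M"
  unfolding renyi_integrand_def by measurable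

lemma renyi_integrand_scale:
  assumes "0 \<le> s" "0 \<le> p" "0 \<le> q" "0 < a"
  shows "renyi_integrand a (s * p) (s * q) = ennreal s * renyi_integrand a p q"
proof (cases "s = 0")
  case True
  then show ?thesis by (simp add: renyi_integrand_def)
next
  case False
  then have s: "s > 0" using assms by simp
  show ?thesis
  proof (cases "a < 1")
    case True
    have "s powr a * s powr (1 - a) = s"
      using s by (simp flip: powr_add)
    then have "(s * p) powr a * (s * q) powr (1 - a) = s * (p powr a * q powr (1 - a))"
      using assms by (simp add: powr_mult algebra_simps)
    then show ?thesis
      using True assms by (simp add: renyi_integrand_def ennreal_mult)
  next
    case a: False
    show ?thesis
    proof (cases "q = 0")
      case True
      then show ?thesis
        using a s assms
        by (cases "p = 0") (simp_all add: renyi_integrand_def ennreal_mult_top)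
    next
      case False
      then have q: "q > 0" using assms by simp
      have "s powr a = s * s powr (a - 1)"
        using s by (simp add: powr_diff)
      then have "(s * p) powr a / (s * q) powr (a - 1) = s * (p powr a / q powr (a - 1))"
        using assms s q by (simp add: powr_mult)
      then show ?thesis
        using a s q assms
        by (simp add: renyi_integrand_def divide_ennreal flip: ennreal_mult)
    qed
  qed
qed

lemma renyi_div_simple_eq:
  assumes "prob_space P" "prob_space Q"
    and "sigma_finite_measure \<mu>"
    and [measurable]: "p \<in> borel_measurable \<mu>" "q \<in> borel_measurable \<mu>"
    and nn: "\<And>x. 0 \<le> p x" "\<And>x. 0 \<le> q x"
    and P: "P = density \<mu> (\<lambda>x. ennreal (p x))"
    and Q: "Q = density \<mu> (\<lambda>x. ennreal (q x))"
    and "0 < a"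
  shows "renyi_div_simple a P Q = renyi_div_wrt a \<mu> p q"
proof -
  interpret \<mu>: sigma_finite_measure \<mu> by fact
  interpret P: prob_space P by fact
  interpret Q: prob_space Q by fact
  define \<nu> where "\<nu> = add_measure P Q"
  have sP [measurable_cong]: "sets P = sets \<mu>" and sQ [measurable_cong]: "sets Q = sets \<mu>"
    by (simp_all add: P Q)
  have s\<nu> [measurable_cong]: "sets \<nu> = sets \<mu>"
    by (simp add: \<nu>_def sP)
  have em: "emeasure \<nu> A = emeasure P A + emeasure Q A" for A
    unfolding \<nu>_def by (rule emeasure_add_measure) (simp add: sP sQ)
  define s where "s x = p x + q x" for x
  have s_nn: "0 \<le> s x" for x using nn by (simp add: s_def)
  have [measurable]: "s \<in> borel_measurable \<mu>" unfolding s_def by measurable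
  have \<nu>: "\<nu> = density \<mu> (\<lambda>x. ennreal (s x))"
  proof (rule measure_eqI)
    show "sets \<nu> = sets (density \<mu> (\<lambda>x. ennreal (s x)))" by (simp add: s\<nu>)
    fix A assume "A \<in> sets \<nu>"
    then have A [measurable]: "A \<in> sets \<mu>" by (simp add: s\<nu>)
    show "emeasure \<nu> A = emeasure (density \<mu> (\<lambda>x. ennreal (s x))) A"
      unfolding em
      by (simp add: P Q emeasure_density s_def nn distrib_right flip: nn_integral_add)
  qed
  have fin\<nu>: "finite_measure \<nu>"
  proof (rule finite_measureI)
    show "emeasure \<nu> (space \<nu>) \<noteq> \<infinity>"
      by (simp add: em P.emeasure_eq_measure Q.emeasure_eq_measure flip: ennreal_plus)
  qed
  interpret \<nu>: finite_measure \<nu> by (rule fin\<nu>)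
  have key: "AE x in \<mu>. r x = s x * enn2real (RN_deriv \<nu> R x)"
    if R: "R = density \<mu> (\<lambda>x. ennreal (r x))" "finite_measure R"
      "absolutely_continuous \<nu> R" and [measurable]: "r \<in> borel_measurable \<mu>"
      and r: "\<And>x. 0 \<le> r x" "\<And>x. r x \<le> s x" for R r
  proof -
    interpret R: finite_measure R by fact
    have sR: "sets R = sets \<nu>" by (simp add: R s\<nu>)
    have [measurable]: "RN_deriv \<nu> R \<in> borel_measurable \<mu>"
      using borel_measurable_RN_deriv[of \<nu> R] by measurable
    have "density \<mu> (\<lambda>x. ennreal (r x)) = density \<nu> (RN_deriv \<nu> R)"
      using \<nu>.density_RN_deriv[OF R(3) sR] R(1) by simp
    also have "\<dots> = density \<mu> (\<lambda>x. ennreal (s x) * RN_deriv \<nu> R x)"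
      by (subst \<nu>) (rule density_density_eq; measurable)
    finally have 1: "AE x in \<mu>. ennreal (r x) = ennreal (s x) * RN_deriv \<nu> R x"
      by (intro \<mu>.density_unique) measurable
    have "AE x in \<nu>. RN_deriv \<nu> R x \<noteq> \<infinity>"
      by (rule \<nu>.RN_deriv_finite) (use R.sigma_finite_measure_axioms R(3) sR in auto)
    then have 2: "AE x in \<mu>. 0 < s x \<longrightarrow> RN_deriv \<nu> R x \<noteq> \<infinity>"
      by (subst (asm) \<nu>) (simp add: AE_density)
    from 1 2 show ?thesis
    proof eventually_elim
      case (elim x)
      show ?case
      proof (cases "s x = 0")
        case True
        then show ?thesis using r[of x] by simp
      next
        case False
        then have "RN_deriv \<nu> R x \<noteq> \<infinity>" using elim s_nn[of x] by simp
        then obtain t where t: "RN_deriv \<nu> R x = ennreal t" "0 \<le> t"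
          by (cases "RN_deriv \<nu> R x") auto
        then show ?thesis
          using elim(1) r[of x] s_nn[of x] by (simp flip: ennreal_mult)
      qed
    qed
  qed
  have acP: "absolutely_continuous \<nu> P" and acQ: "absolutely_continuous \<nu> Q"
    by (auto simp: absolutely_continuous_def null_sets_def em sP sQ s\<nu>)
  have keyP: "AE x in \<mu>. p x = s x * enn2real (RN_deriv \<nu> P x)"
    by (rule key[OF P P.finite_measure_axioms acP]) (auto simp: nn s_def)
  have keyQ: "AE x in \<mu>. q x = s x * enn2real (RN_deriv \<nu> Q x)"
    by (rule key[OF Q Q.finite_measure_axioms acQ]) (auto simp: nn s_def)
  let ?f = "\<lambda>x. renyi_integrand a (enn2real (RN_deriv \<nu> P x)) (enn2real (RN_deriv \<nu> Q x))"
  have "?f \<in> borel_measurable \<nu>" by measurable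
  then have f [measurable]: "?f \<in> borel_measurable \<mu>"
    using measurable_cong_sets[OF s\<nu> refl] by blast
  have "(\<integral>\<^sup>+x. ?f x \<partial>\<nu>) = (\<integral>\<^sup>+x. ?f x \<partial>density \<mu> (\<lambda>x. ennreal (s x)))"
    using \<nu> by (metis (no_types))
  also have "\<dots> = (\<integral>\<^sup>+x. ennreal (s x) * ?f x \<partial>\<mu>)"
    by (rule nn_integral_density) measurable
  also have "\<dots> = (\<integral>\<^sup>+x. renyi_integrand a (p x) (q x) \<partial>\<mu>)"
    using keyP keyQ
  proof (intro nn_integral_cong_AE, eventually_elim)
    case (elim x)
    then show ?case
      using renyi_integrand_scale[OF s_nn[of x] _ _ \<open>0 < a\<close>,
        of "enn2real (RN_deriv \<nu> P x)" "enn2real (RN_deriv \<nu> Q x)"] by simp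
  qed
  finally show ?thesis
    by (simp add: renyi_div_simple_def renyi_div_wrt_def \<nu>_def)
qed

end

theory Submission
  imports Defs
begin

text \<open>
  For finite orders \<open>a \<noteq> 1\<close> the function \<open>(p, q) \<mapsto> p\<^sup>a q\<^sup>1\<^sup>-\<^sup>a\<close> is positively
  homogeneous, and superadditive if \<open>a < 1\<close>, subadditive if \<open>a > 1\<close>. So the integral defining
  the divergence of the mixtures is at least (resp. at most) the corresponding convex combination
  of the two integrals, hence at least their minimum (resp. at most their maximum), and
  \<open>ln / (a - 1)\<close> is decreasing (resp. increasing).

  The orders \<open>0\<close>, \<open>1\<close>, \<open>\<infinity>\<close> follow by passing to the limit. Since \<^const>\<open>Lim\<close> is unspecified
  when no limit exists, convergence must be shown first; it follows from monotonicity of the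
  divergence in its order, which is Hoelder's inequality for
  \<open>p\<^sup>c q\<^sup>1\<^sup>-\<^sup>c = (p\<^sup>d q\<^sup>1\<^sup>-\<^sup>d)\<^sup>t p\<^sup>1\<^sup>-\<^sup>t\<close> with \<open>c - 1 = t (d - 1)\<close>.
\<close>

section \<open>Monotonicity of the divergence in its order\<close>

lemma ln_ennreal_mono: "x \<le> y \<Longrightarrow> ln_ennreal x \<le> ln_ennreal y"
  by (cases x; cases y) (auto simp: ln_ennreal_def top_unique ennreal_le_iff)

text \<open>Serves the orders below \<open>1\<close>, where the factor \<open>1 / (a - 1)\<close> in
  front of the logarithm is negative.\<close>

lemma ereal_mult_left_antimono:
  fixes x y :: ereal
  assumes "x \<le> y" "c \<le> 0"
  shows "ereal c * y \<le> ereal c * x"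
  using ereal_mult_left_mono[of x y "ereal (- c)"] assms
  by (metis ereal_less_eq(5) ereal_minus_le_minus ereal_mult_minus_left neg_0_le_iff_le uminus_ereal.simps(1))

text \<open>Young's inequality with a free scale \<open>K\<close>; the choice \<open>K = Y\<close> yields \<open>X \<le> Y\<^sup>t\<close>, and
  letting \<open>K\<close> tend to \<open>0\<close> covers \<open>Y = 0\<close>.\<close>

lemma ln_ennreal_le_of_young:
  assumes "0 < t" "t < 1"
    and young: "\<And>K. 0 < K \<Longrightarrow>
      X \<le> ennreal (t * K powr (t - 1)) * Y + ennreal ((1 - t) * K powr t)"
  shows "ln_ennreal X \<le> ereal t * ln_ennreal Y"
proof (cases Y)
  case top
  then show ?thesis using assms by (simp add: ln_ennreal_def)
next
  case (real y)
  show ?thesis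
  proof (cases "y = 0")
    case True
    have "X \<le> 0 + ennreal e" if "0 < e" for e
    proof -
      \<comment> \<open>The scale \<open>K = e powr (1 / t)\<close> is the one with
        \<open>K powr t = e\<close>.\<close>
      have "X \<le> ennreal ((1 - t) * (e powr (1 / t)) powr t)"
        using young[of "e powr (1 / t)"] that True real by simp
      also have "\<dots> = ennreal ((1 - t) * e)"
        using that assms by (simp add: powr_powr)
      also have "\<dots> \<le> ennreal e"
        using that assms by (intro ennreal_leI) (simp add: mult_left_le_one_le)
      finally show ?thesis by simp
    qed
    then have "X \<le> 0" by (rule ennreal_le_epsilon)
    then show ?thesis using assms by (simp add: ln_ennreal_def)
  next
    case False
    then have y: "0 < y" using real by simp
    have "X \<le> ennreal (t * y powr (t - 1)) * ennreal y + ennreal ((1 - t) * y powr t)"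
      using young[OF y] real by simp
    also have "\<dots> = ennreal (t * y powr (t - 1) * y + (1 - t) * y powr t)"
      using y assms by (simp add: ennreal_mult' ennreal_plus)
    also have "t * y powr (t - 1) * y + (1 - t) * y powr t = y powr t"
      using y by (simp add: powr_diff algebra_simps)
    finally have "ln_ennreal X \<le> ln_ennreal (ennreal (y powr t))"
      by (rule ln_ennreal_mono)
    also have "\<dots> = ereal t * ln_ennreal Y"
      using y real by (simp add: ln_ennreal_def ln_powr)
    finally show ?thesis .
  qed
qed

text \<open>Away from zeros the two branches of \<open>renyi_integrand\<close> agree, so orders
  below and above \<open>1\<close> can share one Young estimate.\<close>

lemma renyi_integrand_pos:
  assumes "0 < p" "0 < q"
  shows "renyi_integrand a p q = ennreal (p powr a * q powr (1 - a))"
proof (cases "a < 1")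
  case False
  have "1 / q powr (a - 1) = q powr (1 - a)"
    using assms by (simp add: powr_minus_divide[symmetric])
  then have "p powr a / q powr (a - 1) = p powr a * q powr (1 - a)"
    by (metis times_divide_eq_right mult.right_neutral)
  then show ?thesis
    using False assms by (simp add: renyi_integrand_def divide_ennreal)
qed (simp add: renyi_integrand_def)

text \<open>For positive \<open>p\<close> and \<open>q\<close>, with
  \<open>f = p powr d * q powr (1 - d)\<close>, the relation between \<open>c\<close> and
  \<open>d\<close> makes the left side equal to \<open>f powr t * p powr (1 - t)\<close>. Young's
  inequality is applied to \<open>f / K\<close> and \<open>p\<close>, and the factor
  \<open>K powr t\<close> is put back afterwards.\<close>

lemma renyi_integrand_young:
  assumes "0 \<le> p" "0 \<le> q" "0 < K" "0 < t" "t < 1" "c = 1 + t * (d - 1)" "0 < c" "0 < d" "d \<noteq> 1"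
  shows "renyi_integrand c p q
    \<le> ennreal (t * K powr (t - 1)) * renyi_integrand d p q + ennreal ((1 - t) * K powr t) * ennreal p"
proof -
  have cd: "c < 1 \<longleftrightarrow> d < 1" "c \<noteq> 1"
    using assms by (auto simp: mult_less_0_iff)
  consider "p = 0" | "0 < p" "q = 0" | "0 < p" "0 < q" using assms by linarith
  then show ?thesis
  proof cases
    case 1
    then show ?thesis by (simp add: renyi_integrand_def)
  next
    case 2
    \<comment> \<open>The orders \<open>c\<close> and \<open>d\<close> lie on the same side of
      \<open>1\<close>. Below \<open>1\<close> the left side is \<open>0\<close>; above
      \<open>1\<close> the right side is infinite.\<close>
    then show ?thesis
      using assms cd by (cases "d < 1") (auto simp: renyi_integrand_def ennreal_mult_top)
  next
    case 3
    let ?f = "p powr d * q powr (1 - d)"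
    have f: "0 < ?f" using 3 by simp
    have 1: "p powr c * q powr (1 - c) = ?f powr t * p powr (1 - t)"
    proof -
      have "?f powr t * p powr (1 - t) = p powr (d * t + (1 - t)) * q powr ((1 - d) * t)"
        using 3 by (simp add: powr_mult powr_powr powr_add)
      also have "d * t + (1 - t) = c" using assms by (simp add: algebra_simps)
      also have "(1 - d) * t = 1 - c" using assms by (simp add: algebra_simps)
      finally show ?thesis by simp
    qed
    also have "\<dots> = K powr t * ((?f / K) powr t * p powr (1 - t))"
      using f assms by (simp add: powr_divide)
    also have "\<dots> \<le> K powr t * (t * (?f / K) + (1 - t) * p)"
      using Youngs_inequality_0[of t "1 - t" "?f / K" p] f 3 assms
      by (intro mult_left_mono) auto
    also have "\<dots> = t * K powr (t - 1) * ?f + (1 - t) * K powr t * p"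
      using assms by (simp add: powr_diff algebra_simps)
    finally have "ennreal (p powr c * q powr (1 - c))
        \<le> ennreal (t * K powr (t - 1) * ?f + (1 - t) * K powr t * p)"
      by (rule ennreal_leI)
    also have "\<dots> = ennreal (t * K powr (t - 1)) * ennreal ?f + ennreal ((1 - t) * K powr t) * ennreal p"
      using assms 3 by (simp add: ennreal_plus flip: ennreal_mult)
    finally show ?thesis
      by (simp only: renyi_integrand_pos[OF 3])
  qed
qed

text \<open>Hoelder's inequality in logarithmic form. Integrating the pointwise Young bound leaves a
  constant second term because \<open>p\<close> has integral \<open>1\<close>; optimising over
  \<open>K\<close> is the task of \<open>ln_ennreal_le_of_young\<close>, which also covers zero and
  infinite integrals.\<close>

lemma ln_renyi_integral_le:
  assumes [measurable]: "p \<in> borel_measurable \<mu>" "q \<in> borel_measurable \<mu>"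
    and nn: "\<And>x. 0 \<le> p x" "\<And>x. 0 \<le> q x"
    and p: "(\<integral>\<^sup>+x. ennreal (p x) \<partial>\<mu>) = 1"
    and t: "0 < t" "t < 1" and cd: "c = 1 + t * (d - 1)" "0 < c" "0 < d" "d \<noteq> 1"
  shows "ln_ennreal (\<integral>\<^sup>+x. renyi_integrand c (p x) (q x) \<partial>\<mu>)
    \<le> ereal t * ln_ennreal (\<integral>\<^sup>+x. renyi_integrand d (p x) (q x) \<partial>\<mu>)"
proof (rule ln_ennreal_le_of_young[OF t])
  fix K :: real assume "0 < K"
  have "(\<integral>\<^sup>+x. renyi_integrand c (p x) (q x) \<partial>\<mu>)
    \<le> (\<integral>\<^sup>+x. ennreal (t * K powr (t - 1)) * renyi_integrand d (p x) (q x)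
          + ennreal ((1 - t) * K powr t) * ennreal (p x) \<partial>\<mu>)"
    by (intro nn_integral_mono renyi_integrand_young nn \<open>0 < K\<close> t cd)
  also have "\<dots> = ennreal (t * K powr (t - 1)) * (\<integral>\<^sup>+x. renyi_integrand d (p x) (q x) \<partial>\<mu>)
      + ennreal ((1 - t) * K powr t)"
    by (simp add: nn_integral_add nn_integral_cmult p)
  finally show "(\<integral>\<^sup>+x. renyi_integrand c (p x) (q x) \<partial>\<mu>)
    \<le> ennreal (t * K powr (t - 1)) * (\<integral>\<^sup>+x. renyi_integrand d (p x) (q x) \<partial>\<mu>)
      + ennreal ((1 - t) * K powr t)" .
qed

text \<open>On either side of \<open>1\<close>, the order nearer to \<open>1\<close> takes the role
  of \<open>c\<close> in \<open>ln_renyi_integral_le\<close> and the other that of \<open>d\<close>.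
  Multiplying by \<open>1 / (c - 1)\<close> turns the factor \<open>t\<close> into
  \<open>1 / (d - 1)\<close>; below \<open>1\<close> this multiplier is negative and reverses the
  inequality, which fits the exchanged roles of \<open>a\<close> and \<open>b\<close>.\<close>

lemma renyi_div_wrt_mono:
  assumes [measurable]: "p \<in> borel_measurable \<mu>" "q \<in> borel_measurable \<mu>"
    and nn: "\<And>x. 0 \<le> p x" "\<And>x. 0 \<le> q x"
    and p: "(\<integral>\<^sup>+x. ennreal (p x) \<partial>\<mu>) = 1"
    and ab: "0 < a" "a \<le> b" "b < 1 \<or> 1 < a"
  shows "renyi_div_wrt a \<mu> p q \<le> renyi_div_wrt b \<mu> p q"
proof (cases "a = b")
  case False
  then have "a < b" using ab by simp
  let ?L = "\<lambda>c. ln_ennreal (\<integral>\<^sup>+x. renyi_integrand c (p x) (q x) \<partial>\<mu>)"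
  note L = ln_renyi_integral_le[OF assms(1,2) nn p]
  from ab(3) show ?thesis
  proof
    assume b: "b < 1"
    define t where "t = (b - 1) / (a - 1)"
    have t: "0 < t" "t < 1" "b = 1 + t * (a - 1)"
      using b \<open>a < b\<close> by (auto simp: t_def field_simps)
    have "1 / (b - 1) * t = 1 / (a - 1)"
      using b \<open>a < b\<close> by (simp add: t_def)
    then have "ereal (1 / (a - 1)) * ?L a = ereal (1 / (b - 1)) * (ereal t * ?L a)"
      by (metis mult.assoc times_ereal.simps(1))
    also have "\<dots> \<le> ereal (1 / (b - 1)) * ?L b"
      using b \<open>a < b\<close> ab by (intro ereal_mult_left_antimono L t) auto
    finally show ?thesis by (simp add: renyi_div_wrt_def)
  next
    assume a: "1 < a"
    define t where "t = (a - 1) / (b - 1)"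
    have t: "0 < t" "t < 1" "a = 1 + t * (b - 1)"
      using a \<open>a < b\<close> by (auto simp: t_def field_simps)
    have eq: "1 / (a - 1) * t = 1 / (b - 1)"
      using a \<open>a < b\<close> by (simp add: t_def)
    have "ereal (1 / (a - 1)) * ?L a \<le> ereal (1 / (a - 1)) * (ereal t * ?L b)"
      using a \<open>a < b\<close> by (intro ereal_mult_left_mono L t) auto
    also have "\<dots> = ereal (1 / (b - 1)) * ?L b"
      using eq by (metis mult.assoc times_ereal.simps(1))
    finally show ?thesis by (simp add: renyi_div_wrt_def)
  qed
qed simp

section \<open>Additivity inequalities and quasi-convexity for densities\<close>

text \<open>After division by the right side \<open>?S\<close>, Young's inequality bounds each
  summand by a weighted mean of its shares of \<open>x + y\<close> and of \<open>u + v\<close>. The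
  shares of the two summands add up to \<open>1\<close>.\<close>

lemma powr_mult_superadditive:
  fixes x y u v :: real
  assumes "0 < a" "a < 1" "0 \<le> x" "0 \<le> y" "0 \<le> u" "0 \<le> v"
  shows "x powr a * u powr (1 - a) + y powr a * v powr (1 - a)
    \<le> (x + y) powr a * (u + v) powr (1 - a)"
proof (cases "x + y = 0 \<or> u + v = 0")
  case True
  then show ?thesis using assms by (auto simp: add_nonneg_eq_0_iff)
next
  case False
  then have s: "0 < x + y" "0 < u + v" using assms by auto
  let ?S = "(x + y) powr a * (u + v) powr (1 - a)"
  have young: "z powr a * w powr (1 - a) \<le> ?S * (a * (z / (x + y)) + (1 - a) * (w / (u + v)))"
    if "0 \<le> z" "0 \<le> w" for z w :: real
  proof (cases "z = 0 \<or> w = 0")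
    case True
    then show ?thesis using s assms that by auto
  next
    case False
    then have "(z / (x + y)) powr a * (w / (u + v)) powr (1 - a)
        \<le> a * (z / (x + y)) + (1 - a) * (w / (u + v))"
      using s assms that by (intro Youngs_inequality_0) auto
    then have "?S * ((z / (x + y)) powr a * (w / (u + v)) powr (1 - a))
        \<le> ?S * (a * (z / (x + y)) + (1 - a) * (w / (u + v)))"
      by (intro mult_left_mono) auto
    moreover have "?S * ((z / (x + y)) powr a * (w / (u + v)) powr (1 - a)) = z powr a * w powr (1 - a)"
      using s that by (simp add: powr_divide)
    ultimately show ?thesis by simp
  qed
  have "x powr a * u powr (1 - a) + y powr a * v powr (1 - a)
      \<le> ?S * (a * (x / (x + y)) + (1 - a) * (u / (u + v)))
        + ?S * (a * (y / (x + y)) + (1 - a) * (v / (u + v)))"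
    using assms by (intro add_mono young)
  also have "\<dots> = ?S * (a * ((x + y) / (x + y)) + (1 - a) * ((u + v) / (u + v)))"
    unfolding add_divide_distrib distrib_left by (simp only: ac_simps)
  also have "\<dots> = ?S" using s by simp
  finally show ?thesis .
qed

lemma renyi_integrand_superadditive:
  assumes "0 < a" "a < 1" "0 \<le> p" "0 \<le> p'" "0 \<le> q" "0 \<le> q'"
  shows "renyi_integrand a p q + renyi_integrand a p' q' \<le> renyi_integrand a (p + p') (q + q')"
  using powr_mult_superadditive[of a p p' q q'] assms
  by (simp add: renyi_integrand_def ennreal_leI flip: ennreal_plus)

text \<open>With \<open>f = p\<^sup>a q\<^sup>1\<^sup>-\<^sup>a\<close> one has \<open>p = f\<^sup>1\<^sup>/\<^sup>a q\<^sup>1\<^sup>-\<^sup>1\<^sup>/\<^sup>a\<close>, so the case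
  of order \<open>a > 1\<close> reduces to superadditivity at order \<open>1 / a < 1\<close>.\<close>

lemma renyi_integrand_subadditive:
  assumes "1 < a" "0 \<le> p" "0 \<le> p'" "0 \<le> q" "0 \<le> q'"
  shows "renyi_integrand a (p + p') (q + q') \<le> renyi_integrand a p q + renyi_integrand a p' q'"
\<comment> \<open>In the first case a summand on the right is infinite; otherwise all three
  integrands are finite and can be treated as reals.\<close>
proof (cases "0 < p \<and> q = 0 \<or> 0 < p' \<and> q' = 0")
  case True
  then show ?thesis using assms by (auto simp: renyi_integrand_def)
next
  case False
  define f where "f z w = z powr a / w powr (a - 1)" for z w :: real
  have eq: "renyi_integrand a z w = ennreal (f z w)"
    if "z = 0 \<or> 0 < w" for z w
    using that assms by (auto simp: renyi_integrand_def f_def divide_ennreal)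
  have root: "f z w powr (1 / a) * w powr (1 - 1 / a) = z"
    if "0 \<le> z" "0 \<le> w" "z = 0 \<or> 0 < w" for z w
  proof (cases "z = 0")
    case False
    then have "w powr ((a - 1) * (1 / a)) = w powr (1 - 1 / a)"
      using assms by (simp add: field_simps)
    then show ?thesis
      using False that assms by (simp add: f_def powr_divide powr_powr)
  qed (use assms in \<open>simp add: f_def\<close>)
  have ok: "p = 0 \<or> 0 < q" "p' = 0 \<or> 0 < q'" "p + p' = 0 \<or> 0 < q + q'"
    using False assms by auto
  have nn: "0 \<le> f z w" for z w by (simp add: f_def)
  have "p + p' \<le> (f p q + f p' q') powr (1 / a) * (q + q') powr (1 - 1 / a)"
    using powr_mult_superadditive[of "1 / a" "f p q" "f p' q'" q q'] assms nn ok
    by (simp add: root)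
  then have "(p + p') powr a \<le> ((f p q + f p' q') powr (1 / a) * (q + q') powr (1 - 1 / a)) powr a"
    using assms by (intro powr_mono2) auto
  also have "\<dots> = (f p q + f p' q') * (q + q') powr (a - 1)"
  proof -
    have "(1 - 1 / a) * a = a - 1" using assms by (simp add: field_simps)
    then show ?thesis using assms nn by (simp add: powr_mult powr_powr)
  qed
  \<comment> \<open>If \<open>q + q' = 0\<close>, the left side is a real division by zero, hence
    \<open>0\<close>. This is the intended value, since \<open>ok\<close> then gives
    \<open>p + p' = 0\<close>.\<close>
  finally have "f (p + p') (q + q') \<le> f p q + f p' q'"
    using nn[of p q] nn[of p' q'] by (cases "q + q' = 0") (auto simp: f_def[of "p + p'"] f_def[of 0 0] divide_le_eq)
  then show ?thesis
    using ok nn by (simp add: eq ennreal_leI flip: ennreal_plus)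
qed

lemma renyi_div_wrt_quasiconvex:
  assumes [measurable]: "p \<in> borel_measurable \<mu>" "q \<in> borel_measurable \<mu>"
      "p' \<in> borel_measurable \<mu>" "q' \<in> borel_measurable \<mu>"
    and nn: "\<And>x. 0 \<le> p x" "\<And>x. 0 \<le> q x" "\<And>x. 0 \<le> p' x" "\<And>x. 0 \<le> q' x"
    and a: "0 < a" "a \<noteq> 1" and l: "0 < l" "l < 1"
  shows "renyi_div_wrt a \<mu> (\<lambda>x. (1 - l) * p x + l * p' x) (\<lambda>x. (1 - l) * q x + l * q' x)
    \<le> max (renyi_div_wrt a \<mu> p q) (renyi_div_wrt a \<mu> p' q')"
proof -
  let ?F = "\<lambda>p q. \<integral>\<^sup>+x. renyi_integrand a (p x) (q x) \<partial>\<mu>"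
  let ?P = "\<lambda>x. (1 - l) * p x + l * p' x" and ?Q = "\<lambda>x. (1 - l) * q x + l * q' x"
  have w: "ennreal (1 - l) + ennreal l = 1" using l by (simp flip: ennreal_plus)
  \<comment> \<open>Homogeneity moves the weights onto the densities, so that super- and
    subadditivity apply to the scaled pairs.\<close>
  have mix: "ennreal (1 - l) * ?F p q + ennreal l * ?F p' q'
      = (\<integral>\<^sup>+x. renyi_integrand a ((1 - l) * p x) ((1 - l) * q x)
            + renyi_integrand a (l * p' x) (l * q' x) \<partial>\<mu>)"
    using l a nn by (simp add: renyi_integrand_scale nn_integral_add nn_integral_cmult)
  show ?thesis
  proof (cases "a < 1")
    case True
    have "min (?F p q) (?F p' q') = (ennreal (1 - l) + ennreal l) * min (?F p q) (?F p' q')"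
      by (simp add: w)
    also have "\<dots> \<le> ennreal (1 - l) * ?F p q + ennreal l * ?F p' q'"
      unfolding distrib_right by (intro add_mono mult_left_mono) auto
    also have "\<dots> \<le> ?F ?P ?Q"
      unfolding mix using True a l nn
      by (intro nn_integral_mono renyi_integrand_superadditive) auto
    finally have "ln_ennreal (min (?F p q) (?F p' q')) \<le> ln_ennreal (?F ?P ?Q)"
      by (rule ln_ennreal_mono)
    then have "ereal (1 / (a - 1)) * ln_ennreal (?F ?P ?Q)
        \<le> ereal (1 / (a - 1)) * ln_ennreal (min (?F p q) (?F p' q'))"
      using True by (intro ereal_mult_left_antimono) auto
    \<comment> \<open>The minimum is one of the two integrals, so the left side is one of the two
      divergences.\<close>
    also have "\<dots> \<le> max (renyi_div_wrt a \<mu> p q) (renyi_div_wrt a \<mu> p' q')"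
      by (auto simp: renyi_div_wrt_def min_def)
    finally show ?thesis by (simp add: renyi_div_wrt_def)
  next
    case False
    have "?F ?P ?Q \<le> ennreal (1 - l) * ?F p q + ennreal l * ?F p' q'"
      unfolding mix using False a l nn
      by (intro nn_integral_mono renyi_integrand_subadditive) auto
    also have "\<dots> \<le> (ennreal (1 - l) + ennreal l) * max (?F p q) (?F p' q')"
      unfolding distrib_right by (intro add_mono mult_left_mono) auto
    also have "\<dots> = max (?F p q) (?F p' q')" by (simp add: w)
    finally have "ln_ennreal (?F ?P ?Q) \<le> ln_ennreal (max (?F p q) (?F p' q'))"
      by (rule ln_ennreal_mono)
    then have "ereal (1 / (a - 1)) * ln_ennreal (?F ?P ?Q)
        \<le> ereal (1 / (a - 1)) * ln_ennreal (max (?F p q) (?F p' q'))"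
      using False by (intro ereal_mult_left_mono) auto
    also have "\<dots> \<le> max (renyi_div_wrt a \<mu> p q) (renyi_div_wrt a \<mu> p' q')"
      by (auto simp: renyi_div_wrt_def max_def)
    finally show ?thesis by (simp add: renyi_div_wrt_def)
  qed
qed

section \<open>Transfer from densities to probability measures\<close>

lemma finite_measure_add_measure:
  assumes "finite_measure M" "finite_measure N" "sets N = sets M"
  shows "finite_measure (add_measure M N)"
proof (rule finite_measureI)
  have "space N = space M" using assms(3) by (rule sets_eq_imp_space_eq)
  then show "emeasure (add_measure M N) (space (add_measure M N)) \<noteq> \<infinity>"
    using assms finite_measure.emeasure_finite[of M] finite_measure.emeasure_finite[of N]
    by (simp add: emeasure_add_measure)
qed

text \<open>The Radon-Nikodym derivative takes values in \<open>ennreal\<close>; it is finite almost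
  everywhere because \<open>P\<close> is finite, so \<open>enn2real\<close> changes it only on a
  null set.\<close>

lemma real_density_exists:
  assumes "finite_measure \<mu>" "finite_measure P" "sets P = sets \<mu>" "absolutely_continuous \<mu> P"
  obtains p :: "'a \<Rightarrow> real"
  where "p \<in> borel_measurable \<mu>" "\<And>x. 0 \<le> p x" "P = density \<mu> (\<lambda>x. ennreal (p x))"
proof -
  interpret \<mu>: finite_measure \<mu> by fact
  interpret P: finite_measure P by fact
  let ?p = "\<lambda>x. enn2real (RN_deriv \<mu> P x)"
  have "AE x in \<mu>. RN_deriv \<mu> P x \<noteq> \<infinity>"
    using assms P.sigma_finite_measure_axioms by (intro \<mu>.RN_deriv_finite) auto
  then have "AE x in \<mu>. RN_deriv \<mu> P x = ennreal (?p x)"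
    by eventually_elim (auto simp: ennreal_enn2real_if)
  then have "density \<mu> (RN_deriv \<mu> P) = density \<mu> (\<lambda>x. ennreal (?p x))"
    by (intro density_cong) auto
  then show ?thesis
    using \<mu>.density_RN_deriv[OF assms(4,3)] by (intro that[of ?p]) auto
qed

lemma nn_integral_density_1:
  assumes "prob_space P" "P = density \<mu> (\<lambda>x. ennreal (p x))" "p \<in> borel_measurable \<mu>"
  shows "(\<integral>\<^sup>+x. ennreal (p x) \<partial>\<mu>) = 1"
proof -
  have "emeasure P (space \<mu>) = 1"
    using prob_space.emeasure_space_1[OF assms(1)] by (simp add: assms(2))
  moreover have "emeasure P (space \<mu>) = (\<integral>\<^sup>+x. ennreal (p x) \<partial>\<mu>)"
    using assms(3) unfolding assms(2)
    by (subst emeasure_density) (auto intro!: nn_integral_cong)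
  ultimately show ?thesis by simp
qed

lemma mixture_density:
  assumes [measurable]: "p \<in> borel_measurable \<mu>" "p' \<in> borel_measurable \<mu>"
    and nn: "\<And>x. 0 \<le> p x" "\<And>x. 0 \<le> p' x" and l: "0 \<le> l" "l \<le> 1"
  shows "mixture l (density \<mu> (\<lambda>x. ennreal (p x))) (density \<mu> (\<lambda>x. ennreal (p' x)))
    = density \<mu> (\<lambda>x. ennreal ((1 - l) * p x + l * p' x))"
proof (rule measure_eqI)
  fix A assume "A \<in> sets (mixture l (density \<mu> (\<lambda>x. ennreal (p x))) (density \<mu> (\<lambda>x. ennreal (p' x))))"
  then have [measurable]: "A \<in> sets \<mu>" by simp
  show "emeasure (mixture l (density \<mu> (\<lambda>x. ennreal (p x))) (density \<mu> (\<lambda>x. ennreal (p' x)))) A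
      = emeasure (density \<mu> (\<lambda>x. ennreal ((1 - l) * p x + l * p' x))) A"
    using nn l
    by (simp add: emeasure_mixture emeasure_density ennreal_plus ennreal_mult distrib_right
        nn_integral_add mult.assoc nn_integral_cmult)
qed simp

lemma renyi_div_simple_mono:
  assumes "prob_space P" "prob_space Q" "sets Q = sets P"
    and ab: "0 < a" "a \<le> b" "b < 1 \<or> 1 < a"
  shows "renyi_div_simple a P Q \<le> renyi_div_simple b P Q"
proof -
  interpret P: prob_space P by fact
  interpret Q: prob_space Q by fact
  define \<nu> where "\<nu> = add_measure P Q"
  have em: "emeasure \<nu> A = emeasure P A + emeasure Q A" for A
    unfolding \<nu>_def using assms(3) by (rule emeasure_add_measure)
  have s: "sets \<nu> = sets P" by (simp add: \<nu>_def)
  have fin: "finite_measure \<nu>"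
    unfolding \<nu>_def using assms(3)
    by (intro finite_measure_add_measure P.finite_measure_axioms Q.finite_measure_axioms)
  have ac: "absolutely_continuous \<nu> P" "absolutely_continuous \<nu> Q"
    by (auto simp: absolutely_continuous_def null_sets_def em s assms(3))
  obtain p where p: "p \<in> borel_measurable \<nu>" "\<And>x. 0 \<le> p x" "P = density \<nu> (\<lambda>x. ennreal (p x))"
    using real_density_exists[OF fin P.finite_measure_axioms _ ac(1)] s by metis
  obtain q where q: "q \<in> borel_measurable \<nu>" "\<And>x. 0 \<le> q x" "Q = density \<nu> (\<lambda>x. ennreal (q x))"
    using real_density_exists[OF fin Q.finite_measure_axioms _ ac(2)] s assms(3) by metis
  have eq: "renyi_div_simple c P Q = renyi_div_wrt c \<nu> p q" if "0 < c" for c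
    using that p q fin assms(1,2)
    by (intro renyi_div_simple_eq) (auto simp: finite_measure_def)
  show ?thesis
    using renyi_div_wrt_mono[OF p(1) q(1) p(2) q(2) nn_integral_density_1[OF assms(1) p(3) p(1)] ab] ab
    by (simp add: eq)
qed

text \<open>The three divergences are defined through three different dominating measures. The sum
  of all four distributions dominates them and both mixtures, and \<open>renyi_div_simple_eq\<close>
  rewrites every divergence over it; the densities of the mixtures are the mixed densities.\<close>

lemma renyi_div_simple_quasiconvex:
  assumes prob: "prob_space P" "prob_space Q" "prob_space P'" "prob_space Q'"
    and sets: "sets Q = sets P" "sets P' = sets P" "sets Q' = sets P"
    and l: "0 < l" "l < 1" and a: "0 < a" "a \<noteq> 1"
  shows "renyi_div_simple a (mixture l P P') (mixture l Q Q')
    \<le> max (renyi_div_simple a P Q) (renyi_div_simple a P' Q')"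
proof -
  define \<nu> where "\<nu> = add_measure (add_measure P Q) (add_measure P' Q')"
  have fin: "finite_measure \<nu>"
    unfolding \<nu>_def using prob sets
    by (intro finite_measure_add_measure) (simp_all add: prob_space_def)
  have em: "emeasure \<nu> A = emeasure P A + emeasure Q A + (emeasure P' A + emeasure Q' A)" for A
    by (simp add: \<nu>_def emeasure_add_measure sets)
  have s: "sets \<nu> = sets P" by (simp add: \<nu>_def)
  have ex: "\<exists>r. r \<in> borel_measurable \<nu> \<and> (\<forall>x. 0 \<le> r x) \<and> R = density \<nu> (\<lambda>x. ennreal (r x))"
    if R: "R \<in> {P, Q, P', Q'}" for R
  proof -
    have sR: "sets R = sets \<nu>" "finite_measure R" using R sets s prob by (auto simp: prob_space_def)
    have "absolutely_continuous \<nu> R"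
      using R sets by (auto simp: absolutely_continuous_def null_sets_def em s)
    from real_density_exists[OF fin sR(2,1) this] show ?thesis by metis
  qed
  obtain p where p: "p \<in> borel_measurable \<nu>" "\<And>x. 0 \<le> p x" "P = density \<nu> (\<lambda>x. ennreal (p x))"
    using ex[of P] by auto
  obtain q where q: "q \<in> borel_measurable \<nu>" "\<And>x. 0 \<le> q x" "Q = density \<nu> (\<lambda>x. ennreal (q x))"
    using ex[of Q] by auto
  obtain p' where p': "p' \<in> borel_measurable \<nu>" "\<And>x. 0 \<le> p' x" "P' = density \<nu> (\<lambda>x. ennreal (p' x))"
    using ex[of P'] by auto
  obtain q' where q': "q' \<in> borel_measurable \<nu>" "\<And>x. 0 \<le> q' x" "Q' = density \<nu> (\<lambda>x. ennreal (q' x))"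
    using ex[of Q'] by auto
  have sf: "sigma_finite_measure \<nu>" using fin by (simp add: finite_measure_def)
  have mP: "mixture l P P' = density \<nu> (\<lambda>x. ennreal ((1 - l) * p x + l * p' x))"
    using mixture_density[OF p(1) p'(1) p(2) p'(2), of l] l
    by (simp flip: p(3) p'(3))
  have mQ: "mixture l Q Q' = density \<nu> (\<lambda>x. ennreal ((1 - l) * q x + l * q' x))"
    using mixture_density[OF q(1) q'(1) q(2) q'(2), of l] l
    by (simp flip: q(3) q'(3))
  have "renyi_div_simple a P Q = renyi_div_wrt a \<nu> p q"
    by (rule renyi_div_simple_eq[OF prob(1,2) sf p(1) q(1) p(2) q(2) p(3) q(3) a(1)])
  moreover have "renyi_div_simple a P' Q' = renyi_div_wrt a \<nu> p' q'"
    by (rule renyi_div_simple_eq[OF prob(3,4) sf p'(1) q'(1) p'(2) q'(2) p'(3) q'(3) a(1)])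
  moreover have "renyi_div_simple a (mixture l P P') (mixture l Q Q')
      = renyi_div_wrt a \<nu> (\<lambda>x. (1 - l) * p x + l * p' x) (\<lambda>x. (1 - l) * q x + l * q' x)"
  proof (rule renyi_div_simple_eq)
    show "prob_space (mixture l P P')" "prob_space (mixture l Q Q')"
      using prob sets l by (auto intro!: prob_space_mixture)
    show "(\<lambda>x. (1 - l) * p x + l * p' x) \<in> borel_measurable \<nu>"
      "(\<lambda>x. (1 - l) * q x + l * q' x) \<in> borel_measurable \<nu>"
      using p(1) p'(1) q(1) q'(1) by measurable
    show "0 \<le> (1 - l) * p x + l * p' x" "0 \<le> (1 - l) * q x + l * q' x" for x
      using p(2) p'(2) q(2) q'(2) l by auto
  qed (fact sf mP mQ a)+
  ultimately show ?thesis
    using renyi_div_wrt_quasiconvex[OF p(1) q(1) p'(1) q'(1) p(2) q(2) p'(2) q'(2) a l]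
    by (simp only:)
qed

section \<open>Passage to the orders 0, 1 and infinity\<close>

text \<open>Stated for an arbitrary filter so that one proof serves \<open>at_left 1\<close> and
  \<open>at_top\<close>. Each \<open>f x\<close> with \<open>x \<in> S\<close> is an eventual lower
  bound of \<open>f\<close>, and the supremum is an eventual upper bound.\<close>

lemma tendsto_SUP_eventually_mono:
  fixes f :: "'a \<Rightarrow> ereal"
  assumes ev: "\<forall>\<^sub>F x in F. x \<in> S"
    and mono: "\<And>x. x \<in> S \<Longrightarrow> \<forall>\<^sub>F y in F. f x \<le> f y"
  shows "(f \<longlongrightarrow> (SUP x\<in>S. f x)) F"
proof (rule order_tendstoI)
  fix y assume "y < (SUP x\<in>S. f x)"
  then obtain x where "x \<in> S" "y < f x" by (auto simp: less_SUP_iff)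
  then show "\<forall>\<^sub>F x in F. y < f x"
    using mono[of x] by (auto elim: eventually_mono)
next
  fix y assume "(SUP x\<in>S. f x) < y"
  then show "\<forall>\<^sub>F x in F. f x < y"
    using ev by (auto elim!: eventually_mono intro: le_less_trans SUP_upper)
qed

text \<open>The dual statement, for \<open>at_right 0\<close>, where the divergence decreases to its
  infimum over the orders in \<open>(0,1)\<close>.\<close>

lemma tendsto_INF_eventually_mono:
  fixes f :: "'a \<Rightarrow> ereal"
  assumes ev: "\<forall>\<^sub>F x in F. x \<in> S"
    and mono: "\<And>x. x \<in> S \<Longrightarrow> \<forall>\<^sub>F y in F. f y \<le> f x"
  shows "(f \<longlongrightarrow> (INF x\<in>S. f x)) F"
proof (rule order_tendstoI)
  fix y assume "(INF x\<in>S. f x) < y"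
  then obtain x where "x \<in> S" "f x < y" by (auto simp: INF_less_iff)
  then show "\<forall>\<^sub>F x in F. f x < y"
    using mono[of x] by (auto elim: eventually_mono)
next
  fix y assume "y < (INF x\<in>S. f x)"
  then show "\<forall>\<^sub>F x in F. y < f x"
    using ev by (auto elim!: eventually_mono intro: less_le_trans INF_lower)
qed

text \<open>Makes \<open>Lim\<close> a genuine limit. Each filter stays on one side of order
  \<open>1\<close>, so monotonicity within \<open>(0,1)\<close> or within
  \<open>(1,\<infinity>)\<close> suffices and the two ranges are never compared.\<close>

lemma renyi_div_simple_tendsto_Lim:
  assumes "prob_space P" "prob_space Q" "sets Q = sets P"
    and F: "F = at_right 0 \<or> F = at_left 1 \<or> F = at_top"
  shows "((\<lambda>a. renyi_div_simple a P Q) \<longlongrightarrow> Lim F (\<lambda>a. renyi_div_simple a P Q)) F"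
proof -
  let ?f = "\<lambda>a. renyi_div_simple a P Q"
  note mono = renyi_div_simple_mono[OF assms(1-3)]
  from F have "\<exists>L. (?f \<longlongrightarrow> L) F"
  proof (elim disjE)
    assume F: "F = at_right 0"
    have "(?f \<longlongrightarrow> (INF a\<in>{0<..<1}. ?f a)) (at_right 0)"
    proof (rule tendsto_INF_eventually_mono)
      fix x :: real assume "x \<in> {0<..<1}"
      then show "\<forall>\<^sub>F y in at_right 0. ?f y \<le> ?f x"
        using eventually_at_right_real[of 0 x] by (auto elim!: eventually_mono intro!: mono)
    qed (rule eventually_at_right_real, simp)
    then show ?thesis using F by auto
  next
    assume F: "F = at_left 1"
    have "(?f \<longlongrightarrow> (SUP a\<in>{0<..<1}. ?f a)) (at_left 1)"
    proof (rule tendsto_SUP_eventually_mono)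
      fix x :: real assume "x \<in> {0<..<1}"
      then show "\<forall>\<^sub>F y in at_left 1. ?f x \<le> ?f y"
        using eventually_at_left_real[of x 1] by (auto elim!: eventually_mono intro!: mono)
    qed (rule eventually_at_left_real, simp)
    then show ?thesis using F by auto
  next
    assume F: "F = at_top"
    have "(?f \<longlongrightarrow> (SUP a\<in>{1<..}. ?f a)) at_top"
    proof (rule tendsto_SUP_eventually_mono)
      fix x :: real assume "x \<in> {1<..}"
      then show "\<forall>\<^sub>F y in at_top. ?f x \<le> ?f y"
        by (intro eventually_mono[OF eventually_ge_at_top[of x]] mono) auto
    qed (use eventually_gt_at_top[of "1::real"] in simp)
    then show ?thesis using F by auto
  qed
  moreover have "F \<noteq> bot" using F by (elim disjE) simp_all
  ultimately show ?thesis by (metis tendsto_Lim)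
qed

text \<open>Each of the three filters eventually lies in the positive orders other than
  \<open>1\<close>, where quasi-convexity is already available; the inequality passes to the limit
  since \<open>max\<close> is continuous.\<close>

lemma Lim_renyi_div_simple_quasiconvex:
  assumes prob: "prob_space P" "prob_space Q" "prob_space P'" "prob_space Q'"
    and sets: "sets Q = sets P" "sets P' = sets P" "sets Q' = sets P"
    and l: "0 < l" "l < 1" and F: "F = at_right 0 \<or> F = at_left 1 \<or> F = at_top"
  shows "Lim F (\<lambda>a. renyi_div_simple a (mixture l P P') (mixture l Q Q'))
    \<le> max (Lim F (\<lambda>a. renyi_div_simple a P Q)) (Lim F (\<lambda>a. renyi_div_simple a P' Q'))"
proof (rule tendsto_le)
  show "F \<noteq> bot" using F by (elim disjE) simp_all
  show "((\<lambda>a. max (renyi_div_simple a P Q) (renyi_div_simple a P' Q'))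
      \<longlongrightarrow> max (Lim F (\<lambda>a. renyi_div_simple a P Q)) (Lim F (\<lambda>a. renyi_div_simple a P' Q'))) F"
    using prob sets F by (intro tendsto_max renyi_div_simple_tendsto_Lim) auto
  show "((\<lambda>a. renyi_div_simple a (mixture l P P') (mixture l Q Q'))
      \<longlongrightarrow> Lim F (\<lambda>a. renyi_div_simple a (mixture l P P') (mixture l Q Q'))) F"
    using prob sets l F
    by (intro renyi_div_simple_tendsto_Lim prob_space_mixture) auto
  have "\<forall>\<^sub>F a::real in at_top. 0 < a \<and> a \<noteq> 1"
    by (rule eventually_mono[OF eventually_gt_at_top[of 1]]) auto
  then have "\<forall>\<^sub>F a in F. 0 < a \<and> a \<noteq> 1"
    using F eventually_at_right_real[of 0 1] eventually_at_left_real[of 0 1]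
    by (auto elim: eventually_mono)
  then show "\<forall>\<^sub>F a in F. renyi_div_simple a (mixture l P P') (mixture l Q Q')
      \<le> max (renyi_div_simple a P Q) (renyi_div_simple a P' Q')"
    by eventually_elim (rule renyi_div_simple_quasiconvex[OF prob sets l], simp_all)
qed

section \<open>Quasi-convexity at every order\<close>

theorem theorem13:
  fixes M P\<^sub>0 P\<^sub>1 Q\<^sub>0 Q\<^sub>1 :: "'a measure" and \<alpha> :: ennreal and l :: real
  assumes "prob_space P\<^sub>0" "prob_space Q\<^sub>0" "prob_space P\<^sub>1" "prob_space Q\<^sub>1"
    and "sets P\<^sub>0 = sets M" "sets Q\<^sub>0 = sets M" "sets P\<^sub>1 = sets M" "sets Q\<^sub>1 = sets M"
    and "0 < l" "l < 1"
  shows "renyi_div \<alpha> (mixture l P\<^sub>0 P\<^sub>1) (mixture l Q\<^sub>0 Q\<^sub>1)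
    \<le> max (renyi_div \<alpha> P\<^sub>0 Q\<^sub>0) (renyi_div \<alpha> P\<^sub>1 Q\<^sub>1)"
proof -
  have s: "sets Q\<^sub>0 = sets P\<^sub>0" "sets P\<^sub>1 = sets P\<^sub>0" "sets Q\<^sub>1 = sets P\<^sub>0"
    using assms by auto
  note lim = Lim_renyi_div_simple_quasiconvex[OF assms(1-4) s assms(9,10)]
  note simple = renyi_div_simple_quasiconvex[OF assms(1-4) s assms(9,10)]
  consider "\<alpha> = 0" | "\<alpha> = 1" | "\<alpha> = \<infinity>" | "\<alpha> \<noteq> 0" "\<alpha> \<noteq> 1" "\<alpha> \<noteq> \<infinity>" by blast
  then show ?thesis
  proof cases
    case 1
    then show ?thesis using lim[of "at_right 0"] by (simp add: renyi_div_def)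
  next
    case 2
    then show ?thesis using lim[of "at_left 1"] by (simp add: renyi_div_def)
  next
    case 3
    then show ?thesis using lim[of at_top] by (simp add: renyi_div_def)
  next
    case 4
    then have "0 < enn2real \<alpha>" "enn2real \<alpha> \<noteq> 1"
      by (cases \<alpha>; simp add: less_le)+
    then show ?thesis using 4 simple[of "enn2real \<alpha>"] by (simp add: renyi_div_def)
  qed
qed

end
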